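(* Let $m\geq 5$ be an integer and let $\mathcal{P}$ be a digital $(0,m,2)$-net in base $2$ that is a NUT net or a NLT net. Then $$\mathrm{disp}(\mathcal{P})\geq \frac52\cdot\frac{1}{2^m}.$$
   Context: Dispersion: let $\mathcal{B}:=\{[x_1,y_1)\times[x_2,y_2)\mid 0\le x_1\le y_1\le 1,\ 0\le x_2\le y_2\le 1\}$. For a finite point set $\mathcal{P}\subset[0,1]^2$, $\mathrm{disp}(\mathcal{P}):=\sup_{B\in\mathcal{B},\,B\cap\mathcal{P}=\emptyset}\lambda(B)$, where $\lambda(B)$ is the area of $B$. Digital nets in base $2$: identify $\mathbb{Z}_2$, the field with $2$ elements, with $\{0,1\}$. Let $C_1,C_2$ be two $m\times m$ matrices over $\mathbb{Z}_2$. For $n\in\{0,1,\dots,2^m-1\}$ with binary expansion $n=e_1+2e_2+\dots+2^{m-1}e_m$, $e_i\in\{0,1\}$, put $\vec n=(e_1,\dots,e_m)^\top$, compute $C_j\vec n=:(y^{(j)}_{n,1},\dots,y^{(j)}_{n,m})^\top$ over $\mathbb{Z}_2$, set $x_n^{(j)}=\sum_{i=1}^m y^{(j)}_{n,i}\,2^{-i}$ for $j=1,2$, and $\boldsymbol{x}_n=(x_n^{(1)},x_n^{(2)})$. The digital net generated by $C_1$ and $C_2$ is $\{\boldsymbol{x}_0,\dots,\boldsymbol{x}_{2^m-1}\}$. Let $J_m$ be the $m\times m$ matrix with entries $1$ on the anti-diagonal (positions $(i,m+1-i)$) and $0$ elsewhere. A NUT net is a digital net generated by $C_1=J_m$ and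 a nonsingular upper triangular matrix $C_2$ over $\mathbb{Z}_2$; a NLT net is a digital net generated by $C_1=J_m$ and a nonsingular lower triangular matrix $C_2$ over $\mathbb{Z}_2$. A digital $(0,m,2)$-net in base $2$ is a digital net such that every interval $\left[\frac{a_1}{2^{j_1}},\frac{a_1+1}{2^{j_1}}\right)\times\left[\frac{a_2}{2^{j_2}},\frac{a_2+1}{2^{j_2}}\right)$ with integers $j_1,j_2\ge0$, $j_1+j_2=m$, $0\le a_i<2^{j_i}$, contains exactly one of its points; equivalently, for all integers $d_1,d_2\ge 0$ with $d_1+d_2=m$, the first $d_1$ rows of $C_1$ together with the first $d_2$ rows of $C_2$ are linearly independent over $\mathbb{Z}_2$. *)

theory Defs
  imports
    "HOL-Analysis.Analysis"
    "HOL-Library.Z2"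
    "Jordan_Normal_Form.Matrix"
begin

unbundle no vec_syntax
hide_const (open) Finite_Cartesian_Product.vec
hide_type (open) Finite_Cartesian_Product.vec

section \<open>Dispersion\<close>

definition boxes :: "(real \<times> real) set set" where
  "boxes = {{x1..<y1} \<times> {x2..<y2} | x1 y1 x2 y2.
              0 \<le> x1 \<and> x1 \<le> y1 \<and> y1 \<le> 1 \<and> 0 \<le> x2 \<and> x2 \<le> y2 \<and> y2 \<le> 1}"

text \<open>
  The supremum in \<^typ>\<open>real\<close> is a genuine one: the set of areas is bounded by 1, and it is
  nonempty because \<^const>\<open>boxes\<close> contains the empty box.
\<close>

definition disp :: "(real \<times> real) set \<Rightarrow> real" where
  "disp P = (SUP B \<in> {B \<in> boxes. B \<inter> P = {}}. measure lborel B)"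

lemma measure_box:
  assumes "x1 \<le> y1" "x2 \<le> y2"
  shows "measure lborel ({x1..<y1} \<times> {x2..<y2} :: (real \<times> real) set) = (y1 - x1) * (y2 - x2)"
  using assms
  by (simp add: lborel_prod[symmetric] lborel.emeasure_pair_measure_Times measure_def enn2real_mult)

lemma disp_wellposed:
  shows "{B \<in> boxes. B \<inter> P = {}} \<noteq> {}"
    and "bdd_above (measure lborel ` {B \<in> boxes. B \<inter> P = {}})"
proof -
  have "({0..<0} \<times> {0..<0} :: (real \<times> real) set) \<in> boxes"
    unfolding boxes_def by (intro CollectI exI[of _ 0]) simp
  then show "{B \<in> boxes. B \<inter> P = {}} \<noteq> {}"
    by auto
  show "bdd_above (measure lborel ` {B \<in> boxes. B \<inter> P = {}})"
  proof (rule bdd_aboveI2)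
    fix B assume "B \<in> {B \<in> boxes. B \<inter> P = {}}"
    then obtain x1 y1 x2 y2 :: real where "B = {x1..<y1} \<times> {x2..<y2}"
      and "0 \<le> x1" "x1 \<le> y1" "y1 \<le> 1" "0 \<le> x2" "x2 \<le> y2" "y2 \<le> 1"
      unfolding boxes_def by auto
    then show "measure lborel B \<le> 1"
      by (simp add: measure_box mult_le_one)
  qed
qed

section \<open>Digital nets in base 2\<close>

text \<open>
  The field with two elements is the type \<^typ>\<open>bit\<close>. Rows, columns and digits are numbered
  from 0 here, so entry (i, j) below is entry (i + 1, j + 1) in one-based numbering;
  \<open>digit_vec m n\<close> starts with the least significant digit of \<open>n\<close>.
\<close>

definition digit_vec :: "nat \<Rightarrow> nat \<Rightarrow> bit vec" where
  "digit_vec m n = vec m (\<lambda>i. of_nat (n div 2 ^ i mod 2))"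

definition net_coord :: "nat \<Rightarrow> bit mat \<Rightarrow> nat \<Rightarrow> real" where
  "net_coord m C n = (\<Sum>i<m. of_bit ((C *\<^sub>v digit_vec m n) $ i) / 2 ^ (i + 1))"

definition digital_net :: "nat \<Rightarrow> bit mat \<Rightarrow> bit mat \<Rightarrow> (real \<times> real) set" where
  "digital_net m C1 C2 = (\<lambda>n. (net_coord m C1 n, net_coord m C2 n)) ` {0..<2 ^ m}"

definition is_digital_net :: "nat \<Rightarrow> (real \<times> real) set \<Rightarrow> bool" where
  "is_digital_net m P \<longleftrightarrow>
     (\<exists>C1 \<in> carrier_mat m m. \<exists>C2 \<in> carrier_mat m m. P = digital_net m C1 C2)"

definition elementary_interval :: "nat \<Rightarrow> nat \<Rightarrow> nat \<Rightarrow> nat \<Rightarrow> (real \<times> real) set" where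
  "elementary_interval j1 a1 j2 a2 =
     {real a1 / 2 ^ j1 ..< (real a1 + 1) / 2 ^ j1} \<times> {real a2 / 2 ^ j2 ..< (real a2 + 1) / 2 ^ j2}"

text \<open>
  Nets are sets of points. Counting points without multiplicity makes no difference here: for
  fixed \<open>j1\<close> and \<open>j2\<close> the \<open>2 ^ m\<close> elementary intervals are disjoint, so if each contains
  exactly one point of the set, then the \<open>2 ^ m\<close> generated points are pairwise distinct.
\<close>

definition is_digital_0_m_2_net :: "nat \<Rightarrow> (real \<times> real) set \<Rightarrow> bool" where
  "is_digital_0_m_2_net m P \<longleftrightarrow> is_digital_net m P \<and>
     (\<forall>j1 j2 a1 a2. j1 + j2 = m \<and> a1 < 2 ^ j1 \<and> a2 < 2 ^ j2 \<longrightarrow>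
        (\<exists>!x. x \<in> P \<inter> elementary_interval j1 a1 j2 a2))"

section \<open>NUT and NLT nets\<close>

definition antidiag_mat :: "nat \<Rightarrow> bit mat" where
  "antidiag_mat m = mat m m (\<lambda>(i, j). if i + j + 1 = m then 1 else 0)"

definition lower_triangular :: "'a::zero mat \<Rightarrow> bool" where
  "lower_triangular A \<longleftrightarrow> (\<forall>i < dim_row A. \<forall>j < dim_col A. i < j \<longrightarrow> A $$ (i, j) = 0)"

definition is_NUT_net :: "nat \<Rightarrow> (real \<times> real) set \<Rightarrow> bool" where
  "is_NUT_net m P \<longleftrightarrow> (\<exists>C2 \<in> carrier_mat m m. invertible_mat C2 \<and> upper_triangular C2 \<and>
     P = digital_net m (antidiag_mat m) C2)"

definition is_NLT_net :: "nat \<Rightarrow> (real \<times> real) set \<Rightarrow> bool" where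
  "is_NLT_net m P \<longleftrightarrow> (\<exists>C2 \<in> carrier_mat m m. invertible_mat C2 \<and> lower_triangular C2 \<and>
     P = digital_net m (antidiag_mat m) C2)"

end

theory Submission
  imports Defs "Jordan_Normal_Form.Determinant"
begin

unbundle bit_operations_syntax

text \<open>
  The bound reduces to a finite statement about \<open>5 \<times> 5\<close> matrices, by two observations.

  Exchanging the two coordinates does not change the dispersion, and it turns a NUT net into a NLT
  net (\<open>swap_NUT_net_is_NLT_net\<close>). So let \<open>P\<close> be a NLT net with matrix \<open>L\<close>. Its points are
  \<open>(n / 2 ^ m, Y n / 2 ^ m)\<close> with integers \<open>Y n\<close>. As \<open>L\<close> is lower triangular, the first five
  digits of \<open>Y n\<close> depend only on the last five bits of \<open>n\<close>; they are given by a map \<open>F\<close> on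
  \<open>{0, \<dots>, 31}\<close> that is additive for exclusive or. As the diagonal of \<open>L\<close> consists of ones, there
  are only \<open>2 ^ 10\<close> such maps.

  For each of them a computation finds integers \<open>a < b\<close> and \<open>c < d\<close> with \<open>(b - a) * (d - c) \<ge> 80\<close>
  such that the graph of \<open>F\<close> has no point in the open box between \<open>(a, c)\<close> and \<open>(b, d)\<close>
  (\<open>additive_map_avoids_box\<close>). Four digits would not be enough: already the identity matrix of
  size four admits no such box of the corresponding area \<open>40\<close>.

  The box found is then placed in the unit square, with horizontal unit \<open>1 / 2 ^ m\<close> and vertical
  unit \<open>1 / 2 ^ 5\<close>, inside a vertical strip in which \<open>n\<close> runs through a block of length \<open>32\<close>
  (\<open>disp_ge_grid_box\<close>). The digits of \<open>Y n\<close> that \<open>F\<close> ignores could push one point from the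
  lower side of the box into its interior, but since \<open>P\<close> is a \<open>(0, m, 2)\<close>-net there is a strip in which
  these digits vanish for this point. The area of the box is at least
  \<open>80 / (32 * 2 ^ m) = 5 / 2 * (1 / 2 ^ m)\<close>.
\<close>

section \<open>Binary expansions\<close>

text \<open>
The leading \<open>k\<close> digits of \<open>0.b\<^sub>0b\<^sub>1b\<^sub>2\<dots>\<close>, read as an integer with \<open>b 0\<close> the most significant digit.
\<close>

primrec bin_val :: "(nat \<Rightarrow> bit) \<Rightarrow> nat \<Rightarrow> int" where
  "bin_val b 0 = 0"
| "bin_val b (Suc k) = 2 * bin_val b k + of_bit (b k)"

lemma bin_val_cong: "(\<And>i. i < k \<Longrightarrow> b i = c i) \<Longrightarrow> bin_val b k = bin_val c k"
  by (induction k) auto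

lemma bin_val_div: "bin_val b (k + l) div 2 ^ l = bin_val b k"
proof (induction l)
  case (Suc l)
  have "bin_val b (k + Suc l) div 2 ^ Suc l = bin_val b (k + Suc l) div 2 div 2 ^ l"
    by (simp add: zdiv_zmult2_eq)
  also have "bin_val b (k + Suc l) div 2 = bin_val b (k + l)"
    by simp
  finally show ?case
    using Suc by simp
qed simp

lemma bin_frac_eq_bin_val: "(\<Sum>i<k. of_bit (b i) / 2 ^ (i + 1)) = real_of_int (bin_val b k) / 2 ^ k"
  by (induction k) (auto simp: field_simps)

text \<open>
Addition of digits over the two-element field is carry-free, so it becomes exclusive or on integers.
\<close>

lemma bin_val_add: "bin_val (\<lambda>i. b i + c i) k = bin_val b k XOR bin_val c k"
proof (induction k)
  case (Suc k)
  have "(2 * x + of_bit p) XOR (2 * y + of_bit q) = 2 * (x XOR y) + of_bit (p + q)"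
    for x y :: int and p q :: bit
    by (subst xor_rec) (cases p; cases q; simp)
  then show ?case
    using Suc by simp
qed simp

lemma zdiv_bounds:
  fixes z q :: int
  assumes "0 < q"
  shows "z div q * q \<le> z" "z < (z div q + 1) * q"
  using div_mult_mod_eq[of z q] pos_mod_bound[OF assms, of z] pos_mod_sign[OF assms, of z]
  by (simp_all only: distrib_right mult_1)

lemma bin_val_leading_one:
  assumes "j < k" "b j = 1" "\<And>i. i < j \<Longrightarrow> b i = 0"
  shows "bin_val b k \<in> {2 ^ (k - Suc j)..<2 ^ (k - j)}"
proof -
  have "bin_val b j = bin_val (\<lambda>_. 0) j"
    using assms(3) by (rule bin_val_cong)
  also have "\<dots> = 0"
    by (induction j) simp_all
  finally have "bin_val b j = 0" .
  then have "bin_val b (Suc j) = 1"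
    using assms by simp
  then have "bin_val b k div 2 ^ (k - Suc j) = 1"
    using bin_val_div[of b "Suc j" "k - Suc j"] assms(1) by simp
  moreover have "(2::int) ^ (k - j) = 2 * 2 ^ (k - Suc j)"
    using assms(1) by (metis Suc_diff_Suc power_Suc)
  ultimately show ?thesis
    using zdiv_bounds[of "2 ^ (k - Suc j)" "bin_val b k"] by simp
qed

section \<open>Additive maps on five-bit numbers\<close>

text \<open>
The values at \<open>0, 1, \<dots>, 2 ^ k - 1\<close> of the exclusive-or-additive map that takes the given value
\<open>cs ! j\<close> at \<open>2 ^ j\<close>: each further generator doubles the table.
\<close>

definition xor_span :: "int list \<Rightarrow> int list" where
  "xor_span cs = fold (\<lambda>c vs. vs @ map (\<lambda>v. c XOR v) vs) cs [0]"

lemma xor_span_additive: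
  assumes add: "\<And>n n'. F (n XOR n') = F n XOR F n'"
  shows "xor_span (map (\<lambda>j. F (2 ^ j)) [0..<k]) = map F [0..<2 ^ k]"
proof (induction k)
  case 0
  have "F 0 = 0"
    using add[of 0 0] by simp
  then show ?case
    by (simp add: xor_span_def)
next
  case (Suc k)
  have shift: "F (i + 2 ^ k) = F (2 ^ k) XOR F i" if "i < 2 ^ k" for i
  proof -
    have "i + 2 ^ k = 2 ^ k XOR i"
    proof -
      have "take_bit k i = i"
        using that by (simp add: take_bit_nat_eq_self)
      then have "\<not> bit i k"
        by (metis bit_take_bit_iff less_irrefl)
      then have "i AND 2 ^ k = 0"
        by (simp add: and_exp_eq_0_iff_not_bit)
      then show ?thesis
        by (simp add: disjunctive_add_eq_xor xor.commute)
    qed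
    then show ?thesis
      by (simp add: add)
  qed
  have "[0..<2 ^ Suc k] = [0..<2 ^ k] @ map (\<lambda>i. i + 2 ^ k) [0..<2 ^ k]"
    by (simp add: map_add_upt upt_add_eq_append[of 0 "2 ^ k" "2 ^ k", simplified] mult_2)
  then have "map F [0..<2 ^ Suc k] = map F [0..<2 ^ k] @ map (\<lambda>v. F (2 ^ k) XOR v) (map F [0..<2 ^ k])"
    using shift by simp
  with Suc show ?case
    by (simp add: xor_span_def)
qed

text \<open>
A quadruple \<open>(a, b, c, d)\<close> stands for the open box with corners \<open>(a, c)\<close> and \<open>(b, d)\<close> in the grid of
side \<open>32\<close>. The list has no structure of its own. It comes from a covering search: for each of the
\<open>1024\<close> possible maps some box of the list contains no point of its graph. Boxes that settle many
remaining maps come first, so that the search through the list below is short.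
\<close>

definition empty_boxes :: "(nat \<times> nat \<times> int \<times> int) list" where
  "empty_boxes =
    [(12, 20, 1, 11), (14, 18, 1, 21), (14, 18, 1, 23), (14, 20, 1, 15), (12, 18, 1, 15),
     (2, 18, 10, 15), (4, 20, 4, 9), (14, 30, 10, 15), (6, 22, 8, 13), (10, 26, 8, 13),
     (22, 30, 4, 15), (2, 29, 14, 17), (20, 32, 4, 11), (3, 30, 10, 13), (9, 21, 20, 27),
     (0, 27, 6, 9), (4, 31, 22, 25), (18, 30, 8, 15), (2, 10, 4, 15), (21, 27, 16, 30),
     (13, 19, 16, 31), (5, 11, 16, 30), (11, 23, 20, 27), (15, 27, 20, 27), (23, 29, 16, 31),
     (7, 23, 14, 19)]"

definition avoids_box :: "int list \<Rightarrow> nat \<times> nat \<times> int \<times> int \<Rightarrow> bool" where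
  "avoids_box vs = (\<lambda>(a, b, c, d). list_all (\<lambda>y. y \<le> c \<or> d \<le> y) (take (b - Suc a) (drop (Suc a) vs)))"

definition avoids_some_box :: "int list \<Rightarrow> bool" where
  "avoids_some_box vs = list_ex (avoids_box vs) empty_boxes"

text \<open>
Area \<open>80\<close> is the target because \<open>80 / 32 = 5 / 2\<close>.
\<close>

lemma empty_boxes_large:
  "list_all (\<lambda>(a, b, c, d). a < b \<and> b \<le> 32 \<and> 0 \<le> c \<and> c < d \<and> d \<le> 32 \<and> 80 \<le> int (b - a) * (d - c))
    empty_boxes"
  by code_simp

text \<open>
The generators run through all columns of unit lower triangular \<open>5 \<times> 5\<close> matrices, each column read
as an integer: column \<open>j\<close> starts with \<open>j\<close> zeros followed by a one, which gives the ranges.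
\<close>

lemma every_xor_span_avoids_some_box:
  "list_all (\<lambda>c0. list_all (\<lambda>c1. list_all (\<lambda>c2. list_all (\<lambda>c3.
     avoids_some_box (xor_span [c0, c1, c2, c3, 1])) [2..3]) [4..7]) [8..15]) [16..31]"
  by code_simp

lemma additive_map_avoids_box:
  fixes F :: "nat \<Rightarrow> int"
  assumes add: "\<And>n n'. F (n XOR n') = F n XOR F n'"
    and lead: "\<And>j. j < 5 \<Longrightarrow> F (2 ^ j) \<in> {2 ^ (4 - j)..<2 ^ (5 - j)}"
  obtains a b c d where "a < b" "b \<le> 32" "0 \<le> c" "c < d" "d \<le> 32" "80 \<le> int (b - a) * (d - c)"
    "\<forall>n. a < n \<and> n < b \<longrightarrow> F n \<le> c \<or> d \<le> F n"
proof -
  have mem: "F 1 \<in> set [16..31]" "F 2 \<in> set [8..15]" "F 4 \<in> set [4..7]" "F 8 \<in> set [2..3]" "F 16 = 1"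
    unfolding set_upto using lead[of 0] lead[of 1] lead[of 2] lead[of 3] lead[of 4] by simp_all
  have "\<forall>c0\<in>set [16..31]. \<forall>c1\<in>set [8..15]. \<forall>c2\<in>set [4..7]. \<forall>c3\<in>set [2..3].
      avoids_some_box (xor_span [c0, c1, c2, c3, 1])"
    using every_xor_span_avoids_some_box by (simp only: list_all_iff)
  from this[rule_format, OF mem(1-4)] have "avoids_some_box (xor_span [F 1, F 2, F 4, F 8, F 16])"
    unfolding mem(5) .
  moreover have "xor_span [F 1, F 2, F 4, F 8, F 16] = map F [0..<32]"
    using xor_span_additive[of F 5, OF add] by (simp add: upt_rec)
  ultimately obtain a b c d where abcd: "(a, b, c, d) \<in> set empty_boxes" "avoids_box (map F [0..<32]) (a, b, c, d)"
    unfolding avoids_some_box_def list_ex_iff by auto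
  have large: "a < b" "b \<le> 32" "0 \<le> c" "c < d" "d \<le> 32" "80 \<le> int (b - a) * (d - c)"
    using empty_boxes_large abcd(1) unfolding list_all_iff by auto
  have "F n \<le> c \<or> d \<le> F n" if "a < n" "n < b" for n
  proof -
    have "n \<in> set (take (b - Suc a) (drop (Suc a) [0..<32]))"
      using that large(2) by (simp add: take_upt)
    then show ?thesis
      using abcd(2) by (auto simp: avoids_box_def list_all_iff drop_map take_map)
  qed
  with large show thesis
    using that by blast
qed

section \<open>Lower bounds for the dispersion\<close>

text \<open>
Only half-open boxes are admitted, so an open box whose lower or left side carries points of \<open>P\<close> does not
compete itself. It is exhausted from the inside by admissible boxes, keeping the upper right
corner and scaling both sides by \<open>sqrt z\<close> with \<open>z\<close> tending to one.
\<close>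

lemma disp_ge_open_box:
  assumes "0 \<le> x" "x \<le> x'" "x' \<le> 1" "0 \<le> y" "y \<le> y'" "y' \<le> 1"
    and empty: "P \<inter> {x<..<x'} \<times> {y<..<y'} = {}"
  shows "(x' - x) * (y' - y) \<le> disp P"
proof (rule field_le_mult_one_interval)
  fix z :: real
  assume z: "0 < z" "z < 1"
  define s where "s = sqrt z"
  have s: "0 < s" "s < 1" "s * s = z"
    using z by (auto simp: s_def)
  let ?B = "{x' - s * (x' - x)..<x'} \<times> {y' - s * (y' - y)..<y'}"
  have le: "s * (x' - x) \<le> x' - x" "s * (y' - y) \<le> y' - y"
    using s assms by (auto intro: mult_left_le_one_le)
  have ge: "0 \<le> s * (x' - x)" "0 \<le> s * (y' - y)"
    using s assms by auto
  have lt: "s * (x' - x) < x' - x" if "x < x'"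
    using s that by (simp add: mult_less_cancel_right1)
  have lt': "s * (y' - y) < y' - y" if "y < y'"
    using s that by (simp add: mult_less_cancel_right1)
  have "?B \<in> boxes"
    unfolding boxes_def
    by (rule CollectI, rule exI[of _ "x' - s * (x' - x)"], rule exI[of _ x'],
        rule exI[of _ "y' - s * (y' - y)"], rule exI[of _ y']) (use assms le ge in auto)
  moreover have "?B \<subseteq> {x<..<x'} \<times> {y<..<y'}"
  proof (cases "x < x' \<and> y < y'")
    case True
    then have "s * (x' - x) < x' - x" "s * (y' - y) < y' - y"
      using lt lt' by auto
    then show ?thesis
      by (intro Sigma_mono) (auto simp only: atLeastLessThan_iff greaterThanLessThan_iff subset_iff)
  next
    case False
    then have "x = x' \<or> y = y'" using assms by auto
    then show ?thesis by auto
  qed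
  ultimately have "measure lborel ?B \<le> disp P"
    unfolding disp_def using empty by (intro cSUP_upper disp_wellposed) auto
  then show "z * ((x' - x) * (y' - y)) \<le> disp P"
    using ge by (simp add: measure_box mult.assoc mult.left_commute flip: s(3))
qed

lemma swap_boxes: "B \<in> boxes \<Longrightarrow> prod.swap ` B \<in> boxes"
  unfolding boxes_def by (auto simp: product_swap) blast

lemma disp_swap_le: "disp (prod.swap ` P) \<le> disp P"
  unfolding disp_def
proof (rule cSUP_mono)
  show "{B \<in> boxes. B \<inter> prod.swap ` P = {}} \<noteq> {}"
    by (rule disp_wellposed)
  show "bdd_above (measure lborel ` {B \<in> boxes. B \<inter> P = {}})"
    by (rule disp_wellposed)
  fix B assume B: "B \<in> {B \<in> boxes. B \<inter> prod.swap ` P = {}}"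
  then have "prod.swap ` B \<inter> P = {}"
    by (auto simp: disjoint_iff)
  moreover have "measure lborel B = measure lborel (prod.swap ` B)"
    using B unfolding boxes_def by (auto simp: product_swap measure_box)
  ultimately show "\<exists>B'\<in>{B \<in> boxes. B \<inter> P = {}}. measure lborel B \<le> measure lborel B'"
    using B swap_boxes by auto
qed

section \<open>Grid boxes in nets\<close>

lemma grid_cell:
  fixes z c :: int
  assumes "k \<le> m" "z div 2 ^ (m - k) = c"
  shows "real_of_int z / 2 ^ m \<in> {c / 2 ^ k..<(c + 1) / 2 ^ k}"
proof -
  have pow: "(2::real) ^ m = 2 ^ k * 2 ^ (m - k)"
    using assms by (simp flip: power_add)
  have "c * 2 ^ (m - k) \<le> z" "z < (c + 1) * 2 ^ (m - k)"
    using zdiv_bounds[of "2 ^ (m - k)" z] assms(2) by simp_all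
  then have "real_of_int (c * 2 ^ (m - k)) \<le> z" "real_of_int z < real_of_int ((c + 1) * 2 ^ (m - k))"
    by (simp_all only: of_int_le_iff of_int_less_iff)
  then show ?thesis
    by (auto simp: pow field_simps)
qed

text \<open>
If the first \<open>k\<close> digits of the second coordinate depend only on the last \<open>k\<close> bits of \<open>n\<close>, then
a box empty for these \<open>2 ^ k\<close> truncated points is a candidate in each of the \<open>2 ^ (m - k)\<close> vertical
strips of width \<open>2 ^ k / 2 ^ m\<close>. Truncation moves points down by less than \<open>1 / 2 ^ k\<close>,
which is harmless except for the one point of the strip that is truncated to the lower side \<open>c / 2 ^ k\<close> of
the box: it may really lie inside. The net property supplies a strip where it does not: some
point of the net has second coordinate exactly \<open>c / 2 ^ k\<close>, and in its strip it is the only point that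
is truncated to \<open>c / 2 ^ k\<close>.
\<close>

lemma disp_ge_grid_box:
  fixes Y F :: "nat \<Rightarrow> int" and c d :: int
  assumes net: "is_digital_0_m_2_net m P"
    and P: "P = (\<lambda>n. (real n / 2 ^ m, Y n / 2 ^ m)) ` {0..<2 ^ m}"
    and "k \<le> m"
    and F: "\<And>n. Y n div 2 ^ (m - k) = F (n mod 2 ^ k)"
    and ab: "a < b" "b \<le> 2 ^ k" and cd: "0 \<le> c" "c < d" "d \<le> 2 ^ k"
    and empty: "\<And>n. a < n \<Longrightarrow> n < b \<Longrightarrow> F n \<le> c \<or> d \<le> F n"
  shows "real (b - a) * (d - c) / 2 ^ (k + m) \<le> disp P"
proof -
  have pow: "(2::real) ^ m = 2 ^ k * 2 ^ (m - k)" "(2::int) ^ m = 2 ^ k * 2 ^ (m - k)"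
    "(2::nat) ^ m = 2 ^ k * 2 ^ (m - k)"
    using \<open>k \<le> m\<close> by (simp_all flip: power_add)
  have c_lt: "c < 2 ^ k"
    using cd by simp
  \<comment> \<open>The elementary interval of full width and height \<open>1 / 2 ^ m\<close> pins the second coordinate.\<close>
  have "\<exists>n0 < 2 ^ m. Y n0 = c * 2 ^ (m - k)"
  proof -
    let ?y = "nat c * 2 ^ (m - k)"
    have "?y < 2 ^ m"
      using c_lt cd(1) by (simp add: pow nat_less_iff)
    then have "\<exists>x. x \<in> P \<inter> elementary_interval 0 0 m ?y"
      using net unfolding is_digital_0_m_2_net_def
      by (metis (no_types, lifting) add_0 less_numeral_extra(1) power_0)
    then obtain n0 where "n0 < 2 ^ m" and y: "real ?y / 2 ^ m \<le> Y n0 / 2 ^ m" "Y n0 / 2 ^ m < (real ?y + 1) / 2 ^ m"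
      unfolding P elementary_interval_def by auto
    have "z = int u" if "real u / 2 ^ m \<le> z / 2 ^ m" "z / 2 ^ m < (real u + 1) / 2 ^ m" for u and z :: int
      using that by (simp add: divide_le_cancel divide_less_cancel)
    from this[OF y] have "Y n0 = int ?y" .
    then show ?thesis
      using \<open>n0 < 2 ^ m\<close> cd(1) by auto
  qed
  then obtain n0 where n0: "n0 < 2 ^ m" "Y n0 = c * 2 ^ (m - k)"
    by blast
  define t where "t = n0 div 2 ^ k"
  have t: "t < 2 ^ (m - k)"
    using n0(1) by (simp add: t_def pow less_mult_imp_div_less mult.commute)
  have cell: "(real n / 2 ^ m, Y n / 2 ^ m) \<in> P \<inter> elementary_interval (m - k) t k (nat c)"
    if "n < 2 ^ m" "n div 2 ^ k = t" "Y n div 2 ^ (m - k) = c" for n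
  proof -
    have "int n div 2 ^ (m - (m - k)) = int t"
      using that(2) \<open>k \<le> m\<close> using zdiv_int[of n "2 ^ k"] by simp
    then have "real n / 2 ^ m \<in> {real t / 2 ^ (m - k)..<(real t + 1) / 2 ^ (m - k)}"
      using grid_cell[of "m - k" m "int n" "int t"] by simp
    moreover have "Y n / 2 ^ m \<in> {real (nat c) / 2 ^ k..<(real (nat c) + 1) / 2 ^ k}"
      using grid_cell[of k m "Y n" c] that(3) \<open>k \<le> m\<close> cd(1) by simp
    moreover have "(real n / 2 ^ m, Y n / 2 ^ m) \<in> P"
      unfolding P using that(1) by (intro image_eqI[of _ _ n]) simp_all
    ultimately show ?thesis
      by (simp only: elementary_interval_def mem_Sigma_iff Int_iff)
  qed
  have unique: "n = n0" if "n < 2 ^ m" "n div 2 ^ k = t" "Y n div 2 ^ (m - k) = c" for n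
  proof -
    have "\<exists>!x. x \<in> P \<inter> elementary_interval (m - k) t k (nat c)"
      using net t c_lt cd(1) \<open>k \<le> m\<close> unfolding is_digital_0_m_2_net_def by (simp add: nat_less_iff)
    then have "(real n / 2 ^ m, Y n / 2 ^ m) = (real n0 / 2 ^ m, Y n0 / 2 ^ m)"
      using cell[OF that] cell[OF n0(1)] n0(2) by (metis nonzero_mult_div_cancel_right power_eq_0_iff t_def zero_neq_numeral)
    then show ?thesis
      by simp
  qed
  define x where "x = (real a + 2 ^ k * t) / 2 ^ m"
  define x' where "x' = (real b + 2 ^ k * t) / 2 ^ m"
  have "P \<inter> {x<..<x'} \<times> {c / 2 ^ k<..<d / 2 ^ k} = {}"
  proof (rule ccontr)
    assume "P \<inter> {x<..<x'} \<times> {c / 2 ^ k<..<d / 2 ^ k} \<noteq> {}"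
    then obtain n where n: "n < 2 ^ m" and xn: "x < real n / 2 ^ m" "real n / 2 ^ m < x'"
      and yn: "c / 2 ^ k < Y n / 2 ^ m" "Y n / 2 ^ m < d / 2 ^ k"
      unfolding P by auto
    have "real (a + 2 ^ k * t) < real n" "real n < real (b + 2 ^ k * t)"
      using xn by (simp_all add: x_def x'_def divide_less_cancel)
    then have n_bounds: "a + 2 ^ k * t < n" "n < b + 2 ^ k * t"
      by (simp_all only: of_nat_less_iff)
    define r where "r = n - 2 ^ k * t"
    have r: "n = r + 2 ^ k * t" "a < r" "r < b"
      using n_bounds by (auto simp: r_def)
    then have "r < 2 ^ k"
      using ab by simp
    then have n_dm: "n div 2 ^ k = t" "n mod 2 ^ k = r"
      using r(1) by simp_all
    have "real_of_int (c * 2 ^ (m - k)) < Y n" "real_of_int (Y n) < real_of_int (d * 2 ^ (m - k))"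
      using yn by (simp_all add: pow field_simps)
    then have Yn: "c * 2 ^ (m - k) < Y n" "Y n < d * 2 ^ (m - k)"
      by (simp_all only: of_int_less_iff)
    let ?e = "Y n div 2 ^ (m - k)"
    have e: "?e * 2 ^ (m - k) \<le> Y n" "Y n < (?e + 1) * 2 ^ (m - k)"
      by (rule zdiv_bounds, simp)+
    have "c < ?e + 1"
      using less_trans[OF Yn(1) e(2)] by (rule mult_right_less_imp_less) simp
    moreover have "?e < d"
      using le_less_trans[OF e(1) Yn(2)] by (rule mult_right_less_imp_less) simp
    ultimately have "?e = c"
      using empty[OF r(2,3)] F[of n] n_dm by auto
    then have "n = n0"
      using unique n n_dm by blast
    then show False
      using Yn n0 by simp
  qed
  moreover have "x' \<le> 1"
  proof -
    have "b + 2 ^ k * t \<le> 2 ^ k * Suc t"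
      using ab by simp
    also have "\<dots> \<le> 2 ^ m"
      using t unfolding pow by (intro mult_left_mono) auto
    finally have "real (b + 2 ^ k * t) \<le> real (2 ^ m)"
      by (simp only: of_nat_le_iff)
    then show ?thesis
      by (simp add: x'_def)
  qed
  moreover have "real_of_int d \<le> 2 ^ k"
    using cd(3) by (metis of_int_le_iff of_int_numeral of_int_power)
  ultimately have "(x' - x) * (d / 2 ^ k - c / 2 ^ k) \<le> disp P"
    using ab cd by (intro disp_ge_open_box) (auto simp: x_def x'_def divide_simps)
  moreover have "x' - x = real (b - a) / 2 ^ m"
    using ab by (simp add: x_def x'_def of_nat_diff flip: diff_divide_distrib)
  ultimately show ?thesis
    by (simp add: power_add field_simps)
qed

section \<open>Digital nets as linear images\<close>

definition vec_frac :: "nat \<Rightarrow> bit vec \<Rightarrow> real" where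
  "vec_frac m w = (\<Sum>i<m. of_bit (w $ i) / 2 ^ (i + 1))"

lemma digit_vec_altdef: "digit_vec m n = vec m (\<lambda>i. of_bool (bit n i))"
  by (auto simp: digit_vec_def bit_iff_odd mod_2_eq_odd)

lemma digit_vec_carrier [simp]: "digit_vec m n \<in> carrier_vec m"
  by (simp add: digit_vec_def)

lemma digit_vec_range: "digit_vec m ` {0..<2 ^ m} = carrier_vec m"
proof (intro equalityI subsetI)
  fix v :: "bit vec"
  assume v: "v \<in> carrier_vec m"
  define n :: nat where "n = horner_sum of_bool 2 (map (\<lambda>i. odd (v $ i)) [0..<m])"
  have "n < 2 ^ m"
    using horner_sum_of_bool_2_less[of "map (\<lambda>i. odd (v $ i)) [0..<m]"] by (simp add: n_def)
  moreover have "digit_vec m n = v"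
    using v by (intro eq_vecI) (auto simp: digit_vec_altdef n_def bit_horner_sum_bit_iff)
  ultimately show "v \<in> digit_vec m ` {0..<2 ^ m}"
    by force
qed auto

text \<open>
The digit vectors of \<open>0, \<dots>, 2 ^ m - 1\<close> exhaust the whole space, so the order of enumeration of
the points is immaterial and one may substitute linearly in the index.
\<close>

lemma digital_net_altdef:
  "digital_net m C1 C2 = (\<lambda>v. (vec_frac m (C1 *\<^sub>v v), vec_frac m (C2 *\<^sub>v v))) ` carrier_vec m"
  unfolding digit_vec_range[symmetric] digital_net_def net_coord_def vec_frac_def image_image ..

lemma digital_net_swap: "prod.swap ` digital_net m C1 C2 = digital_net m C2 C1"
  by (auto simp: digital_net_def image_image)

lemma digital_net_base_change:
  assumes "C1 \<in> carrier_mat m m" "C2 \<in> carrier_mat m m" "A \<in> carrier_mat m m" "B \<in> carrier_mat m m"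
    and "A * B = 1\<^sub>m m"
  shows "digital_net m (C1 * A) (C2 * A) = digital_net m C1 C2"
proof -
  have "(\<lambda>v. A *\<^sub>v v) ` carrier_vec m = carrier_vec m"
  proof (intro equalityI subsetI)
    fix v :: "bit vec" assume "v \<in> carrier_vec m"
    then have "v = A *\<^sub>v (B *\<^sub>v v)" "B *\<^sub>v v \<in> carrier_vec m"
      using assms by (simp_all flip: assoc_mult_mat_vec)
    then show "v \<in> (\<lambda>v. A *\<^sub>v v) ` carrier_vec m"
      by blast
  qed (use assms in auto)
  then have "digital_net m C1 C2 =
      (\<lambda>v. (vec_frac m (C1 *\<^sub>v (A *\<^sub>v v)), vec_frac m (C2 *\<^sub>v (A *\<^sub>v v)))) ` carrier_vec m"
    unfolding digital_net_altdef by (metis (no_types, lifting) image_image image_cong)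
  also have "\<dots> = digital_net m (C1 * A) (C2 * A)"
    unfolding digital_net_altdef by (intro image_cong refl) (use assms in \<open>simp add: assoc_mult_mat_vec\<close>)
  finally show ?thesis ..
qed

lemma is_digital_0_m_2_net_swap:
  assumes "is_digital_0_m_2_net m P"
  shows "is_digital_0_m_2_net m (prod.swap ` P)"
  unfolding is_digital_0_m_2_net_def
proof (intro conjI allI impI)
  show "is_digital_net m (prod.swap ` P)"
    using assms digital_net_swap unfolding is_digital_0_m_2_net_def is_digital_net_def by blast
  fix j1 j2 a1 a2 :: nat
  assume "j1 + j2 = m \<and> a1 < 2 ^ j1 \<and> a2 < 2 ^ j2"
  then have ex1: "\<exists>!x. x \<in> P \<inter> elementary_interval j2 a2 j1 a1"
    using assms unfolding is_digital_0_m_2_net_def by (simp add: add.commute)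
  have "x \<in> prod.swap ` P \<inter> elementary_interval j1 a1 j2 a2 \<longleftrightarrow>
      prod.swap x \<in> P \<inter> elementary_interval j2 a2 j1 a1" for x
    by (cases x) (force simp: elementary_interval_def image_iff)
  with ex1 show "\<exists>!x. x \<in> prod.swap ` P \<inter> elementary_interval j1 a1 j2 a2"
    by (metis swap_swap)
qed

section \<open>Reflection turns NUT nets into NLT nets\<close>

lemma antidiag_mat_carrier [simp]: "antidiag_mat m \<in> carrier_mat m m"
  by (simp add: antidiag_mat_def)

lemma antidiag_row: "i < m \<Longrightarrow> row (antidiag_mat m) i = unit_vec m (m - Suc i)"
  by (rule eq_vecI) (auto simp: antidiag_mat_def)

lemma antidiag_col: "j < m \<Longrightarrow> col (antidiag_mat m) j = unit_vec m (m - Suc j)"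
  by (rule eq_vecI) (auto simp: antidiag_mat_def)

lemma antidiag_mult_vec:
  assumes "v \<in> carrier_vec m" "i < m"
  shows "(antidiag_mat m *\<^sub>v v) $ i = v $ (m - Suc i)"
proof -
  have "i < dim_row (antidiag_mat m)"
    using assms(2) by (simp add: antidiag_mat_def)
  then show ?thesis
    using assms by (simp add: antidiag_row scalar_prod_left_unit)
qed

lemma antidiag_conj_index:
  assumes "A \<in> carrier_mat m m" "i < m" "j < m"
  shows "(antidiag_mat m * A * antidiag_mat m) $$ (i, j) = A $$ (m - Suc i, m - Suc j)"
proof -
  have left: "(antidiag_mat m * A) $$ (i, l) = A $$ (m - Suc i, l)" if "l < m" for l
    using assms that carrier_matD[OF antidiag_mat_carrier[of m]]
    by (simp add: antidiag_row scalar_prod_left_unit)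
  have "(antidiag_mat m * A * antidiag_mat m) $$ (i, j) = row (antidiag_mat m * A) i \<bullet> unit_vec m (m - Suc j)"
    using assms carrier_matD[OF antidiag_mat_carrier[of m]] by (simp add: antidiag_col)
  also have "\<dots> = row (antidiag_mat m * A) i $ (m - Suc j)"
    using assms by (intro scalar_prod_right_unit) auto
  also have "\<dots> = (antidiag_mat m * A) $$ (i, m - Suc j)"
    using assms carrier_matD[OF antidiag_mat_carrier[of m]] by simp
  finally show ?thesis
    using assms left by simp
qed

lemma antidiag_mat_involution: "antidiag_mat m * antidiag_mat m = 1\<^sub>m m"
proof (rule eq_matI)
  fix i j assume ij: "i < dim_row (1\<^sub>m m :: bit mat)" "j < dim_col (1\<^sub>m m :: bit mat)"
  have "(antidiag_mat m * antidiag_mat m) $$ (i, j) = (antidiag_mat m *\<^sub>v col (antidiag_mat m) j) $ i"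
    using ij by (simp add: antidiag_mat_def)
  also have "\<dots> = antidiag_mat m $$ (m - Suc i, j)"
    using ij by (subst antidiag_mult_vec) (auto simp: antidiag_mat_def)
  finally show "(antidiag_mat m * antidiag_mat m) $$ (i, j) = 1\<^sub>m m $$ (i, j)"
    using ij by (auto simp: antidiag_mat_def)
qed (simp_all add: antidiag_mat_def)

text \<open>
Row \<open>i\<close> of \<open>B * U = 1\<close> is solved from left to right: once \<open>B $$ (i, l) = 0\<close> for all \<open>l < j\<close>, the
entry \<open>(i, j)\<close> of the product reduces to \<open>B $$ (i, j) * U $$ (j, j)\<close>, and the diagonal of \<open>U\<close> has
no zero because the determinant of \<open>U\<close> divides one.
\<close>

lemma upper_triangular_left_inverse:
  fixes U B :: "'a :: idom mat"
  assumes U: "U \<in> carrier_mat m m" "upper_triangular U" and B: "B \<in> carrier_mat m m"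
    and BU: "B * U = 1\<^sub>m m"
  shows "upper_triangular B"
proof -
  have "det B * det U = 1"
    using det_mult[OF B U(1)] BU by simp
  then have diag: "U $$ (j, j) \<noteq> 0" if "j < m" for j
    using that U upper_triangular_imp_det_eq_0_iff[OF U] by (auto simp: diag_mat_def)
  have "B $$ (i, j) = 0" if "j < i" "i < m" for i j
    using that
  proof (induction j rule: less_induct)
    case (less j)
    have "0 = (B * U) $$ (i, j)"
      using less.prems BU by simp
    also have "\<dots> = (\<Sum>l\<in>{0..<m}. B $$ (i, l) * U $$ (l, j))"
      using less.prems U(1) B by (simp add: scalar_prod_def)
    also have "\<dots> = (\<Sum>l\<in>{0..<m}. if l = j then B $$ (i, l) * U $$ (l, j) else 0)"
    proof (rule sum.cong)
      fix l assume "l \<in> {0..<m}"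
      then show "B $$ (i, l) * U $$ (l, j) = (if l = j then B $$ (i, l) * U $$ (l, j) else 0)"
        using less upper_triangularD[OF U(2), of j l] U(1) by (cases l j rule: linorder_cases) auto
    qed simp
    also have "\<dots> = B $$ (i, j) * U $$ (j, j)"
      using less.prems by simp
    finally show ?case
      using diag[of j] less.prems by simp
  qed
  then show ?thesis
    using B by auto
qed

lemma invertible_mat_inverse:
  assumes "A \<in> carrier_mat m m" "invertible_mat A"
  obtains B where "B \<in> carrier_mat m m" "A * B = 1\<^sub>m m" "B * A = 1\<^sub>m m"
proof -
  obtain B where AB: "A * B = 1\<^sub>m (dim_row A)" and BA: "B * A = 1\<^sub>m (dim_row B)"
    using assms(2) unfolding invertible_mat_def inverts_mat_def by blast
  have "dim_col B = m"
    using arg_cong[OF AB, of dim_col] assms(1) by simp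
  moreover have "dim_row B = m"
    using arg_cong[OF BA, of dim_col] assms(1) by simp
  ultimately show thesis
    using that[of B] AB BA assms(1) by auto
qed

text \<open>
Exchanging the coordinates gives the net generated by \<open>U\<close> and \<open>J\<close>. The base change by \<open>U\<^sup>-\<^sup>1 J\<close>
turns this pair into \<open>J\<close> and \<open>J U\<^sup>-\<^sup>1 J\<close>, and conjugation by \<open>J\<close> reverses the order of rows
and columns, so that the second matrix is lower triangular.
\<close>

lemma swap_NUT_net_is_NLT_net:
  assumes "is_NUT_net m P"
  shows "is_NLT_net m (prod.swap ` P)"
proof -
  let ?J = "antidiag_mat m"
  obtain U where U: "U \<in> carrier_mat m m" "invertible_mat U" "upper_triangular U"
    and P: "P = digital_net m ?J U"
    using assms unfolding is_NUT_net_def by blast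
  obtain B where B: "B \<in> carrier_mat m m" and UB: "U * B = 1\<^sub>m m" and BU: "B * U = 1\<^sub>m m"
    using invertible_mat_inverse[OF U(1,2)] .
  have J: "?J \<in> carrier_mat m m" and JJ: "?J * ?J = 1\<^sub>m m"
    by (simp_all add: antidiag_mat_involution)
  have cancel: "X * ?J * (?J * Y) = X * Y" "X * U * (B * Y) = X * Y" "X * B * (U * Y) = X * Y"
    if "X \<in> carrier_mat m m" "Y \<in> carrier_mat m m" for X Y
  proof -
    have "X * Z * (W * Y) = X * Y" if "Z \<in> carrier_mat m m" "W \<in> carrier_mat m m" "Z * W = 1\<^sub>m m" for Z W
    proof -
      have "X * Z * (W * Y) = X * (Z * (W * Y))"
        using that \<open>X \<in> _\<close> \<open>Y \<in> _\<close> by (intro assoc_mult_mat) auto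
      also have "Z * (W * Y) = Z * W * Y"
        using that \<open>X \<in> _\<close> \<open>Y \<in> _\<close> by (intro assoc_mult_mat[symmetric]) auto
      finally show ?thesis
        using that \<open>Y \<in> _\<close> by simp
    qed
    then show "X * ?J * (?J * Y) = X * Y" "X * U * (B * Y) = X * Y" "X * B * (U * Y) = X * Y"
      using J JJ U(1) B UB BU by blast+
  qed
  let ?L = "?J * B * ?J"
  have L: "?L \<in> carrier_mat m m"
    using J B by (intro mult_carrier_mat)
  have UBJ: "U * (B * ?J) = ?J"
    using cancel(2)[of "1\<^sub>m m" ?J] U B left_mult_one_mat[OF J] by simp
  have JBJ: "?J * (B * ?J) = ?L"
    using J B by (simp add: assoc_mult_mat[of _ m m _ m _ m])
  have "digital_net m (U * (B * ?J)) (?J * (B * ?J)) = digital_net m U ?J"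
  proof (rule digital_net_base_change)
    show "B * ?J * (?J * U) = 1\<^sub>m m"
      using cancel(1)[OF B U(1)] BU by simp
  qed (rule J B U(1) mult_carrier_mat)+
  then have "prod.swap ` P = digital_net m ?J ?L"
    by (simp only: P digital_net_swap UBJ JBJ)
  moreover have "lower_triangular ?L"
  proof -
    have "?L $$ (i, j) = 0" if "i < j" "j < m" for i j
    proof -
      have "?L $$ (i, j) = B $$ (m - Suc i, m - Suc j)"
        using B that by (intro antidiag_conj_index) auto
      also have "\<dots> = 0"
        using upper_triangular_left_inverse[OF U(1,3) B BU] B that by (intro upper_triangularD) auto
      finally show ?thesis .
    qed
    then show ?thesis
      using carrier_matD[OF L] unfolding lower_triangular_def by (simp only:) blast
  qed
  moreover have "invertible_mat ?L"
  proof -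
    have prods: "?J * B \<in> carrier_mat m m" "?J * U \<in> carrier_mat m m"
        "B * ?J \<in> carrier_mat m m" "U * ?J \<in> carrier_mat m m"
      by (rule mult_carrier_mat J U(1) B)+
    have "?L * (?J * U * ?J) = ?J * B * ?J * (?J * (U * ?J))"
      using J U by (simp add: assoc_mult_mat[of _ m m _ m _ m])
    also have "\<dots> = ?J * B * (U * ?J)"
      by (rule cancel(1)[OF prods(1,4)])
    also have "\<dots> = 1\<^sub>m m"
      using cancel(3)[OF J J] JJ by simp
    finally have LI: "?L * (?J * U * ?J) = 1\<^sub>m m" .
    have "?J * U * ?J * ?L = ?J * U * ?J * (?J * (B * ?J))"
      using J B by (simp add: assoc_mult_mat[of _ m m _ m _ m])
    also have "\<dots> = ?J * U * (B * ?J)"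
      by (rule cancel(1)[OF prods(2,3)])
    also have "\<dots> = 1\<^sub>m m"
      using cancel(2)[OF J J] JJ by simp
    finally have "?J * U * ?J * ?L = 1\<^sub>m m" .
    moreover have "dim_row (?J * U * ?J) = m"
      using carrier_matD(1)[OF J] by simp
    ultimately show ?thesis
      using LI carrier_matD[OF L] unfolding invertible_mat_def inverts_mat_def square_mat.simps
      by metis
  qed
  ultimately show ?thesis
    using L unfolding is_NLT_net_def by blast
qed

section \<open>The dispersion of NLT and NUT nets\<close>

lemma net_coord_antidiag:
  assumes "n < 2 ^ m"
  shows "net_coord m (antidiag_mat m) n = real n / 2 ^ m"
proof -
  have "net_coord m (antidiag_mat m) n = (\<Sum>i<m. of_bool (bit n (m - Suc i)) / 2 ^ (i + 1))"
    unfolding net_coord_def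
    by (intro sum.cong refl) (auto simp: antidiag_mult_vec digit_vec_altdef)
  also have "\<dots> = (\<Sum>i<m. of_bool (bit n i) / 2 ^ (m - i))"
    by (rule sum.reindex_bij_witness[of _ "\<lambda>i. m - Suc i" "\<lambda>i. m - Suc i"]) auto
  also have "\<dots> = (\<Sum>i<m. real (of_bool (bit n i) * 2 ^ i)) / 2 ^ m"
    unfolding sum_divide_distrib by (intro sum.cong refl) (auto simp: power_diff)
  also have "(\<Sum>i<m. real (of_bool (bit n i) * 2 ^ i)) = real (take_bit m n)"
    unfolding take_bit_sum by (simp add: push_bit_eq_mult lessThan_atLeast0)
  also have "take_bit m n = n"
    using assms by (simp add: take_bit_nat_eq_self)
  finally show ?thesis .
qed

lemma digit_vec_xor: "digit_vec m (n XOR n') = digit_vec m n + digit_vec m n'"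
  by (rule eq_vecI) (auto simp: digit_vec_altdef bit_xor_iff)

text \<open>
Since \<open>L\<close> is lower triangular, the leading \<open>k\<close> digits of \<open>L *\<^sub>v digit_vec m n\<close> involve only the last
\<open>k\<close> bits of \<open>n\<close>; for \<open>k = 5\<close> they define the additive map to which the finite search applies.
\<close>

lemma disp_NLT_net:
  assumes m: "m \<ge> 5" and net: "is_digital_0_m_2_net m P" and NLT: "is_NLT_net m P"
  shows "5 / 2 * (1 / 2 ^ m) \<le> disp P"
proof -
  obtain L where L: "L \<in> carrier_mat m m" "invertible_mat L" "lower_triangular L"
    and P: "P = digital_net m (antidiag_mat m) L"
    using NLT unfolding is_NLT_net_def by blast
  have zero: "L $$ (i, j) = 0" if "i < j" "j < m" for i j
    using that L(1,3) unfolding lower_triangular_def by auto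
  have one: "L $$ (i, i) = 1" if "i < m" for i
  proof -
    obtain B where B: "B \<in> carrier_mat m m" "L * B = 1\<^sub>m m" "B * L = 1\<^sub>m m"
      using invertible_mat_inverse[OF L(1,2)] .
    then have "det L * det B = 1"
      using det_mult[OF L(1) B(1)] by simp
    moreover have "det L = prod_list (diag_mat L)"
      using zero L(1) by (rule det_lower_triangular)
    ultimately have "0 \<notin> set (diag_mat L)"
      by (metis mult_zero_left prod_list_zero_iff zero_neq_one)
    then show ?thesis
      using that L(1) by (auto simp: diag_mat_def)
  qed
  define y where "y = (\<lambda>n i. (L *\<^sub>v digit_vec m n) $ i)"
  have y_sum: "y n i = (\<Sum>j\<in>{0..<m}. L $$ (i, j) * of_bool (bit n j))" if "i < m" for n i
    using that L(1) by (simp add: y_def digit_vec_altdef scalar_prod_def)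
  have y_low: "y (n mod 2 ^ k) i = y n i" if "i < k" "k \<le> m" for n k i
  proof -
    have "L $$ (i, j) * of_bool (bit (n mod 2 ^ k) j) = L $$ (i, j) * of_bool (bit n j)" if "j < m" for j
      using that zero[of i j] \<open>i < k\<close> by (cases "i < j") (auto simp: bit_take_bit_iff simp flip: take_bit_eq_mod)
    then show ?thesis
      using that by (simp add: y_sum)
  qed
  have y_xor: "y (n XOR n') i = y n i + y n' i" if "i < m" for n n' i
    using that L(1) by (simp add: y_def digit_vec_xor mult_add_distrib_mat_vec[of L m m])
  have y_pow: "y (2 ^ j) i = L $$ (i, j)" if "i < m" "j < m" for i j
  proof -
    have "digit_vec m (2 ^ j) = unit_vec m j"
      using that by (intro eq_vecI) (auto simp: digit_vec_altdef bit_exp_iff)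
    then show ?thesis
      using that L(1) by (simp add: y_def scalar_prod_right_unit)
  qed
  define F where "F n = bin_val (y n) 5" for n
  have "F (n XOR n') = F n XOR F n'" for n n'
  proof -
    have "F (n XOR n') = bin_val (\<lambda>i. y n i + y n' i) 5"
      unfolding F_def using m by (intro bin_val_cong y_xor) simp
    then show ?thesis
      unfolding bin_val_add by (simp only: F_def)
  qed
  moreover have "F (2 ^ j) \<in> {2 ^ (4 - j)..<2 ^ (5 - j)}" if "j < 5" for j
    using bin_val_leading_one[of j 5 "y (2 ^ j)"] that m by (simp add: F_def y_pow one zero)
  ultimately obtain a b c d where box: "a < b" "b \<le> 32" "0 \<le> c" "c < d" "d \<le> 32"
    and area: "80 \<le> int (b - a) * (d - c)"
    and empty: "\<forall>n. a < n \<and> n < b \<longrightarrow> F n \<le> c \<or> d \<le> F n"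
    by (rule additive_map_avoids_box) blast
  have disp_ge: "real (b - a) * (d - c) / 2 ^ (5 + m) \<le> disp P"
  proof (rule disp_ge_grid_box[OF net _ m])
    show "P = (\<lambda>n. (real n / 2 ^ m, bin_val (y n) m / 2 ^ m)) ` {0..<2 ^ m}"
      unfolding P digital_net_def
    proof (intro image_cong refl)
      fix n :: nat assume "n \<in> {0..<2 ^ m}"
      moreover have "net_coord m L n = bin_val (y n) m / 2 ^ m"
        unfolding net_coord_def y_def by (rule bin_frac_eq_bin_val)
      ultimately show "(net_coord m (antidiag_mat m) n, net_coord m L n) = (real n / 2 ^ m, bin_val (y n) m / 2 ^ m)"
        by (simp add: net_coord_antidiag)
    qed
    show "bin_val (y n) m div 2 ^ (m - 5) = F (n mod 2 ^ 5)" for n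
    proof -
      have "bin_val (y n) m div 2 ^ (m - 5) = bin_val (y n) 5"
        using bin_val_div[of "y n" 5 "m - 5"] m by simp
      also have "\<dots> = F (n mod 2 ^ 5)"
        unfolding F_def using m by (intro bin_val_cong y_low[symmetric])
      finally show ?thesis .
    qed
  qed (use box empty in auto)
  have "80 \<le> real (b - a) * (d - c)"
    using area by (metis of_int_le_iff of_int_mult of_int_numeral of_int_of_nat_eq)
  then have "80 / 2 ^ (5 + m) \<le> real (b - a) * (d - c) / 2 ^ (5 + m)"
    by (rule divide_right_mono) simp
  with disp_ge show ?thesis
    by (simp add: power_add)
qed

theorem theorem3p3:
  fixes m :: nat and P :: "(real \<times> real) set"
  assumes "m \<ge> 5"
    and "is_digital_0_m_2_net m P"
    and "is_NUT_net m P \<or> is_NLT_net m P"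
  shows "disp P \<ge> 5 / 2 * (1 / 2 ^ m)"
  using assms(3)
proof
  assume "is_NUT_net m P"
  then have "5 / 2 * (1 / 2 ^ m) \<le> disp (prod.swap ` P)"
    using assms by (intro disp_NLT_net is_digital_0_m_2_net_swap swap_NUT_net_is_NLT_net)
  also have "\<dots> \<le> disp P"
    by (rule disp_swap_le)
  finally show ?thesis .
qed (use assms disp_NLT_net in blast)

end
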